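(* There exists $\delta>0$ such that for all $n$, if $A$ is an independent set of size at least $(1-\delta)(2n-3)!!$ in $\mathcal{M}_n$, then $A$ is contained in a star of $\mathcal{M}_n$.
   Context: The perfect matching graph $\mathcal{M}_n$ has as vertices all perfect matchings of the complete graph $\mathcal{K}_{2n}$ on $2n$ vertices, two matchings being adjacent iff they have no common edge. For an edge $\{a,b\}$ of $\mathcal{K}_{2n}$, the star $\mathcal{S}_{\{a,b\}}$ is the set of all perfect matchings containing $\{a,b\}$. $(2m-1)!!=(2m-1)(2m-3)\cdots1$, with $(-1)!!=1$. *)

theory Defs
  imports Complex_Main "HOL-Library.Ramsey"
begin

text \<open>
  A graph is given by a vertex set and a set of undirected edges (two-element sets of vertices).
  The set of all two-element subsets of \<open>V\<close> is \<open>[V]\<^bsup>2\<^esup>\<close>, and \<open>indep A E\<close> (from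
  HOL-Library.Ramsey) says that no edge of \<open>E\<close> joins two distinct elements of \<open>A\<close>;
  it does not force \<open>A\<close> to consist of vertices.
\<close>

definition independent_set :: "'a set \<Rightarrow> 'a set set \<Rightarrow> 'a set \<Rightarrow> bool" where
  "independent_set V E A \<longleftrightarrow> A \<subseteq> V \<and> indep A E"

definition complete_graph_verts :: "nat \<Rightarrow> nat set" where
  "complete_graph_verts k = {1..k}"

definition complete_graph_edges :: "nat \<Rightarrow> nat set set" where
  "complete_graph_edges k = [complete_graph_verts k]\<^bsup>2\<^esup>"

definition perfect_matching :: "'a set \<Rightarrow> 'a set set \<Rightarrow> 'a set set \<Rightarrow> bool" where
  "perfect_matching V E M \<longleftrightarrow> M \<subseteq> E \<and> (\<forall>v\<in>V. \<exists>!e. e \<in> M \<and> v \<in> e)"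

definition matching_graph_verts :: "nat \<Rightarrow> nat set set set" where
  "matching_graph_verts n =
     {M. perfect_matching (complete_graph_verts (2 * n)) (complete_graph_edges (2 * n)) M}"

definition matching_graph_edges :: "nat \<Rightarrow> nat set set set set" where
  "matching_graph_edges n =
     {{M, N} | M N. M \<in> matching_graph_verts n \<and> N \<in> matching_graph_verts n \<and> M \<inter> N = {}}"

definition star :: "nat \<Rightarrow> nat set \<Rightarrow> nat set set set" where
  "star n e = {M \<in> matching_graph_verts n. e \<in> M}"

text \<open>
  \<open>odd_double_fact m\<close> is \<open>(2m - 1)!!\<close>, the product of the first \<open>m\<close> odd numbers; for \<open>m = 0\<close> the
  empty product gives \<open>(-1)!! = 1\<close>.
\<close>

definition odd_double_fact :: "nat \<Rightarrow> nat" where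
  "odd_double_fact m = (\<Prod>i = 1..m. 2 * i - 1)"

end

theory Submission
  imports Defs "HOL-Library.Disjoint_Sets"
begin

text \<open>
  Let \<open>t\<close> be the least size of a set of edges meeting every member of the intersecting family \<open>A\<close>,
  and let \<open>A\<^sub>S\<close> consist of the members of \<open>A\<close> that contain \<open>S\<close>. If \<open>t = 1\<close>, then \<open>A\<close> lies in a star.
  If \<open>t = 2\<close>, each \<open>A\<^bsub>{e}\<^esub>\<close> consists of matchings that contain \<open>e\<close> and meet a fixed matching avoiding \<open>e\<close>;
  by the Bonferroni inequality of order three these form at most 31/72 of the star of \<open>e\<close>.
  If \<open>t \<ge> 3\<close>, each \<open>S\<close> with fewer than \<open>t\<close> edges is disjoint from some \<open>M \<in> A\<close>, so \<open>A\<^sub>S\<close> is the union of the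
  \<open>A\<^bsub>S \<union> {e}\<^esub>\<close> over the edges \<open>e\<close> of \<open>M\<close> that avoid the vertices of \<open>S\<close>. There are at most \<open>n - |S|\<close> of these,
  and only \<open>n - 2\<close> if \<open>|S| = 1\<close>. Each step thus roughly halves the relative density, which outweighs
  the factor \<open>t\<close> coming from the choice of the first edge.
\<close>

section \<open>Perfect matchings as partitions into pairs\<close>

definition perfect_matchings :: "'a set \<Rightarrow> 'a set set set" where
  "perfect_matchings V = {M. perfect_matching V ([V]\<^bsup>2\<^esup>) M}"

lemma matching_graph_verts_eq: "matching_graph_verts n = perfect_matchings {1..2 * n}"
  by (simp add: matching_graph_verts_def perfect_matchings_def complete_graph_verts_def
      complete_graph_edges_def)

lemma perfect_matchings_iff:
  "M \<in> perfect_matchings V \<longleftrightarrow> partition_on V M \<and> (\<forall>e\<in>M. card e = 2)"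
proof
  assume "M \<in> perfect_matchings V"
  then have sub: "M \<subseteq> [V]\<^bsup>2\<^esup>" and ex: "\<forall>v\<in>V. \<exists>!e. e \<in> M \<and> v \<in> e"
    by (auto simp: perfect_matchings_def perfect_matching_def)
  have "partition_on V M"
  proof (rule partition_onI)
    show "\<Union> M = V"
      using sub ex by (fastforce simp: nsets_def)
    show "disjnt p q" if "p \<in> M" "q \<in> M" "p \<noteq> q" for p q
    proof -
      have "p \<subseteq> V" using that sub by (auto simp: nsets_def)
      then show ?thesis using ex that unfolding disjnt_def by blast
    qed
    show "{} \<notin> M"
      using sub by (auto simp: nsets_def)
  qed
  then show "partition_on V M \<and> (\<forall>e\<in>M. card e = 2)"
    using sub by (auto simp: nsets_def)
next
  assume *: "partition_on V M \<and> (\<forall>e\<in>M. card e = 2)"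
  then have "M \<subseteq> [V]\<^bsup>2\<^esup>"
    by (auto simp: nsets_def partition_on_def intro: card_ge_0_finite)
  moreover have "\<exists>!e. e \<in> M \<and> v \<in> e" if "v \<in> V" for v
  proof -
    have "\<exists>e. e \<in> M \<and> v \<in> e" using * that by (auto simp: partition_on_def)
    moreover have "d = e" if "d \<in> M" "v \<in> d" "e \<in> M" "v \<in> e" for d e
      using * that by (meson disjnt_iff pairwiseD partition_onD2)
    ultimately show ?thesis by blast
  qed
  ultimately show "M \<in> perfect_matchings V"
    by (simp add: perfect_matchings_def perfect_matching_def)
qed

lemma finite_perfect_matchings:
  assumes "finite V"
  shows "finite (perfect_matchings V)"
  using assms by (rule finite_subset[rotated, OF finitely_many_partition_on])
    (auto simp: perfect_matchings_iff)

lemma perfect_matching_finite: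
  assumes "finite V" "M \<in> perfect_matchings V"
  shows "finite M"
  using assms finite_elements by (auto simp: perfect_matchings_iff)

lemma card_Union_pairs:
  assumes "disjoint M" "\<forall>e\<in>M. card e = 2"
  shows "card (\<Union> M) = 2 * card M"
proof -
  have "card (\<Union> M) = sum card M"
    using assms by (intro card_Union_disjoint)
      (auto simp: pairwise_def disjoint_def disjnt_def intro: card_ge_0_finite)
  then show ?thesis using assms by simp
qed

lemma card_perfect_matching:
  assumes "M \<in> perfect_matchings V"
  shows "card V = 2 * card M"
  using assms card_Union_pairs[of M] by (auto simp: perfect_matchings_iff partition_on_def)

text \<open>Deleting \<open>S\<close> and adding it back are inverse bijections. The smaller vertex
  set on the right is the reason for working with matchings on an arbitrary set.\<close>

lemma card_perfect_matchings_superset: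
  assumes "disjoint S" "\<forall>e\<in>S. card e = 2" "\<Union> S \<subseteq> V"
  shows "card {M \<in> perfect_matchings V. S \<subseteq> M} = card (perfect_matchings (V - \<Union> S))"
proof (rule bij_betw_same_card[of "\<lambda>M. M - S"], rule bij_betwI[where g = "\<lambda>M. M \<union> S"])
  show "(\<lambda>M. M - S) \<in> {M \<in> perfect_matchings V. S \<subseteq> M} \<rightarrow> perfect_matchings (V - \<Union> S)"
  proof
    fix M assume "M \<in> {M \<in> perfect_matchings V. S \<subseteq> M}"
    then have M: "partition_on V M" "\<forall>e\<in>M. card e = 2" "S \<subseteq> M"
      by (auto simp: perfect_matchings_iff)
    then have "\<Union> (M - S) = V - \<Union> S"
      by (fastforce simp: partition_on_def disjoint_def)
    then show "M - S \<in> perfect_matchings (V - \<Union> S)"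
      using M by (auto simp: perfect_matchings_iff partition_on_def disjoint_def)
  qed
  show "(\<lambda>M. M \<union> S) \<in> perfect_matchings (V - \<Union> S) \<rightarrow> {M \<in> perfect_matchings V. S \<subseteq> M}"
  proof
    fix M assume "M \<in> perfect_matchings (V - \<Union> S)"
    then have M: "\<Union> M = V - \<Union> S" "disjoint M" "{} \<notin> M" "\<forall>e\<in>M. card e = 2"
      by (auto simp: perfect_matchings_iff partition_on_def)
    have "disjoint (M \<union> S)"
      using M assms by (intro disjoint_union) auto
    then show "M \<union> S \<in> {M \<in> perfect_matchings V. S \<subseteq> M}"
      using M assms by (auto simp: perfect_matchings_iff partition_on_def)
  qed
  show "M - S \<union> S = M" if "M \<in> {M \<in> perfect_matchings V. S \<subseteq> M}" for M
    using that by auto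
  show "M \<union> S - S = M" if "M \<in> perfect_matchings (V - \<Union> S)" for M
  proof -
    have "e \<notin> S" if "e \<in> M" for e
    proof
      assume "e \<in> S"
      moreover have "e \<subseteq> V - \<Union> S" "e \<noteq> {}"
        using \<open>M \<in> _\<close> \<open>e \<in> M\<close> by (auto simp: perfect_matchings_iff partition_on_def)
      ultimately show False by blast
    qed
    then show ?thesis by auto
  qed
qed

section \<open>Counting perfect matchings by double factorials\<close>

lemma odd_double_fact_0 [simp]: "odd_double_fact 0 = 1"
  by (simp add: odd_double_fact_def)

lemma odd_double_fact_Suc: "odd_double_fact (Suc m) = (2 * m + 1) * odd_double_fact m"
  by (simp add: odd_double_fact_def prod.nat_ivl_Suc' )

lemma odd_double_fact_pos: "odd_double_fact m > 0"
  by (induction m) (auto simp: odd_double_fact_Suc)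

text \<open>Split by the partner \<open>u\<close> of a fixed vertex \<open>v\<close>: if
  \<open>card V = 2 * Suc n\<close>, there are \<open>2 * n + 1\<close> partners, and deleting
  \<open>v\<close> and \<open>u\<close> leaves the same problem for \<open>n\<close>.\<close>

lemma card_perfect_matchings:
  assumes "finite V" "card V = 2 * n"
  shows "card (perfect_matchings V) = odd_double_fact n"
  using assms
proof (induction n arbitrary: V)
  case 0
  then have "perfect_matchings V = {{}}"
    by (auto simp: perfect_matchings_iff partition_on_def)
  then show ?case by simp
next
  case (Suc n)
  then obtain v where v: "v \<in> V" by fastforce
  let ?B = "\<lambda>u. {M \<in> perfect_matchings V. {{v, u}} \<subseteq> M}"
  have un: "perfect_matchings V = (\<Union>u\<in>V - {v}. ?B u)"
  proof (intro equalityI subsetI)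
    fix M assume M: "M \<in> perfect_matchings V"
    then obtain e where e: "e \<in> M" "v \<in> e"
      using v by (auto simp: perfect_matchings_iff partition_on_def)
    then have "card e = 2" "e \<subseteq> V"
      using M by (auto simp: perfect_matchings_iff partition_on_def)
    then obtain u where "e = {v, u}" "u \<noteq> v" "u \<in> V"
      using e(2) by (auto simp: card_2_iff)
    then show "M \<in> (\<Union>u\<in>V - {v}. ?B u)" using M e by auto
  qed auto
  have "card (\<Union>u\<in>V - {v}. ?B u) = (\<Sum>u\<in>V - {v}. card (?B u))"
  proof (rule card_UN_disjoint)
    show "\<forall>u\<in>V - {v}. \<forall>w\<in>V - {v}. u \<noteq> w \<longrightarrow> ?B u \<inter> ?B w = {}"
    proof (intro ballI impI)
      fix u w assume "u \<in> V - {v}" "w \<in> V - {v}" "u \<noteq> w"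
      then have *: "{v, u} \<noteq> {v, w}" "\<not> disjnt {v, u} {v, w}" by (auto simp: doubleton_eq_iff)
      have "\<not> ({v, u} \<in> M \<and> {v, w} \<in> M)" if "M \<in> perfect_matchings V" for M
      proof -
        have "disjoint M" using that by (simp add: perfect_matchings_iff partition_on_def)
        then show ?thesis using * pairwiseD[of disjnt M "{v, u}" "{v, w}"] by blast
      qed
      then show "?B u \<inter> ?B w = {}" by blast
    qed
    show "finite (V - {v})" "\<forall>u\<in>V - {v}. finite (?B u)"
      using Suc.prems(1) by (simp_all add: finite_perfect_matchings)
  qed
  moreover have "card (?B u) = odd_double_fact n" if "u \<in> V - {v}" for u
  proof -
    have "card (?B u) = card (perfect_matchings (V - \<Union> {{v, u}}))"
      using that v by (intro card_perfect_matchings_superset) auto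
    also have "\<dots> = odd_double_fact n"
      using that v Suc.prems by (intro Suc.IH) (auto simp: card_Diff_insert card_Diff_subset)
    finally show ?thesis .
  qed
  ultimately have "card (\<Union>u\<in>V - {v}. ?B u) = odd_double_fact (Suc n)"
    using v Suc.prems by (simp add: odd_double_fact_Suc)
  then show ?case by (simp only: un[symmetric])
qed

lemma card_perfect_matchings_containing:
  assumes "finite V" "card V = 2 * n" "disjoint S" "\<forall>e\<in>S. card e = 2" "\<Union> S \<subseteq> V"
  shows "card {M \<in> perfect_matchings V. S \<subseteq> M} = odd_double_fact (n - card S)"
proof -
  have "card (V - \<Union> S) = 2 * (n - card S)"
    using assms finite_subset[OF assms(5,1)] by (simp add: card_Diff_subset card_Union_pairs)
  then show ?thesis
    using assms by (simp add: card_perfect_matchings_superset card_perfect_matchings)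
qed

text \<open>Unless \<open>S\<close> is part of a perfect matching there is nothing to count;
  otherwise the exact formula applies.\<close>

lemma card_perfect_matchings_containing_le:
  assumes "finite V" "card V = 2 * n"
  shows "card {M \<in> perfect_matchings V. S \<subseteq> M} \<le> odd_double_fact (n - card S)"
proof (cases "{M \<in> perfect_matchings V. S \<subseteq> M} = {}")
  case False
  then obtain M where M: "M \<in> perfect_matchings V" "S \<subseteq> M" by blast
  then have "disjoint S" "\<forall>e\<in>S. card e = 2" "\<Union> S \<subseteq> V"
    by (auto simp: perfect_matchings_iff partition_on_def intro: pairwise_subset)
  then show ?thesis by (simp add: card_perfect_matchings_containing[OF assms])
next
  case True
  show ?thesis unfolding True by simp
qed

section \<open>Matchings through an edge that meet a fixed matching\<close>

text \<open>Since \<open>e\<close> is not in \<open>M\<close>, its two ends lie in two different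
  edges of \<open>M\<close>, and these are the only ones that meet \<open>e\<close>.\<close>

lemma card_edges_avoiding_edge:
  assumes "M \<in> perfect_matchings V" "finite V" "e \<subseteq> V" "card e = 2" "e \<notin> M"
  shows "card {d \<in> M. d \<inter> e = {}} = card M - 2"
proof -
  have M: "\<Union> M = V" "disjoint M" "\<forall>d\<in>M. card d = 2"
    using assms by (auto simp: perfect_matchings_iff partition_on_def)
  obtain a b where ab: "e = {a, b}" "a \<noteq> b" using assms by (auto simp: card_2_iff)
  obtain c d where cd: "c \<in> M" "a \<in> c" "d \<in> M" "b \<in> d"
    using assms(3) unfolding ab(1) M(1)[symmetric] by blast
  have "c \<noteq> d"
  proof
    assume "c = d"
    then have "e \<subseteq> c" using cd ab by auto
    moreover have "finite c" "card c = 2" using cd M by (auto intro: card_ge_0_finite)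
    ultimately have "e = c" using card_subset_eq[of c e] assms(4) by simp
    then show False using cd assms by simp
  qed
  moreover have c: "d' = c" if "d' \<in> M" "a \<in> d'" for d'
    using pairwiseD[OF M(2), of d' c] that cd(1,2) by (auto simp: disjnt_iff)
  have d: "d' = d" if "d' \<in> M" "b \<in> d'" for d'
    using pairwiseD[OF M(2), of d' d] that cd(3,4) by (auto simp: disjnt_iff)
  have "d' \<inter> e = {} \<longleftrightarrow> d' \<noteq> c \<and> d' \<noteq> d" if "d' \<in> M" for d'
    using c[OF that] d[OF that] cd(2,4) unfolding ab(1) by blast
  then have "{d \<in> M. d \<inter> e = {}} = M - {c, d}"
    by blast
  ultimately show ?thesis
    using cd by (simp add: card_Diff_subset)
qed

text \<open>The order-three Bonferroni inequality for a single matching with \<open>m\<close> of the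
  given edges, arranged without subtraction. After Pascal's rule the two sides for
  \<open>Suc m\<close> differ only by \<open>m choose 3\<close>.\<close>

lemma binomial_Bonferroni: "m \<ge> 1 \<Longrightarrow> 1 + (m choose 2) \<le> m + (m choose 3)"
proof (induction m rule: dec_induct)
  case (step m)
  have "Suc m choose 2 = m + (m choose 2)" "Suc m choose 3 = (m choose 2) + (m choose 3)"
    by (simp_all add: numeral_2_eq_2 numeral_3_eq_3)
  then show ?case by simp
qed (simp add: numeral_2_eq_2)

text \<open>The union bound alone gives the ratio \<open>k / (2 * k + 1)\<close>, so two cover edges
  could come arbitrarily close to a whole star. With the next two terms the ratio tends to
  \<open>1/2 - 1/8 + 1/48 = 19/48\<close>, below \<open>31/72\<close>; and twice
  \<open>31/72\<close> is below the final \<open>13/15\<close>.\<close>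

lemma Bonferroni_bound:
  "k * odd_double_fact k + (k choose 3) * odd_double_fact (k - 2)
    \<le> 31 / 72 * real (odd_double_fact (k + 1)) + (k choose 2) * odd_double_fact (k - 1)"
proof -
  \<comment> \<open>Values up to 2 are checked directly, so that afterwards no subtraction is
    truncated and the binomials are polynomials in \<open>j = k - 3\<close>.\<close>
  consider "k = 0" | "k = 1" | "k = 2" | j where "k = Suc (Suc (Suc j))"
    by (metis One_nat_def Suc_1 not0_implies_Suc)
  then show ?thesis
  proof cases
    case (4 j)
    have c2: "2 * (Suc (Suc (Suc j)) choose 2) = (j + 3) * (j + 2)"
      by (induction j) (simp_all add: numeral_2_eq_2 algebra_simps)
    have "6 * (Suc (Suc (Suc j)) choose 3) = (j + 3) * (j + 2) * (j + 1)"
    proof (induction j)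
      case (Suc j)
      have "2 * (Suc (Suc (Suc j)) choose 2) = (j + 3) * (j + 2)"
        by (induction j) (simp_all add: numeral_2_eq_2 algebra_simps)
      moreover have "Suc (Suc (Suc (Suc j))) choose 3
          = (Suc (Suc (Suc j)) choose 2) + (Suc (Suc (Suc j)) choose 3)"
        by (simp add: numeral_2_eq_2 numeral_3_eq_3)
      ultimately show ?case using Suc by (simp add: algebra_simps)
    qed (simp add: numeral_3_eq_3)
    then have "6 * real (k choose 3) = real ((j + 3) * (j + 2) * (j + 1))"
      unfolding 4 by (metis of_nat_mult of_nat_numeral)
    then have c3: "real (k choose 3) = (j + 3) * (j + 2) * (j + 1) / 6" by simp
    have "2 * real (k choose 2) = real ((j + 3) * (j + 2))"
      using c2 unfolding 4 by (metis of_nat_mult of_nat_numeral)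
    then have c2: "real (k choose 2) = (j + 3) * (j + 2) / 2" by simp
    \<comment> \<open>\<open>F\<close> is a common factor of all four double factorials; what
      remains is a cubic inequality in \<open>j\<close> that holds coefficient by
      coefficient.\<close>
    define F where "F = real (odd_double_fact (Suc j))"
    have F: "real (odd_double_fact (k - 2)) = F" "real (odd_double_fact (k - 1)) = (2 * j + 3) * F"
      "real (odd_double_fact k) = (2 * j + 5) * (2 * j + 3) * F"
      "real (odd_double_fact (k + 1)) = (2 * j + 7) * (2 * j + 5) * (2 * j + 3) * F"
      unfolding 4 F_def by (simp_all add: odd_double_fact_Suc algebra_simps)
    have "(real j + 3) * ((2 * j + 5) * (2 * j + 3)) + (j + 3) * (j + 2) * (j + 1) / 6
      \<le> 31 / 72 * ((2 * j + 7) * (2 * j + 5) * (2 * j + 3)) + (j + 3) * (j + 2) / 2 * (2 * real j + 3)"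
      by (simp add: field_simps)
    then have "((real j + 3) * ((2 * j + 5) * (2 * j + 3)) + (j + 3) * (j + 2) * (j + 1) / 6) * F
      \<le> (31 / 72 * ((2 * j + 7) * (2 * j + 5) * (2 * j + 3)) + (j + 3) * (j + 2) / 2 * (2 * real j + 3)) * F"
      by (rule mult_right_mono) (simp add: F_def)
    then show ?thesis
      by (simp only: of_nat_mult of_nat_add c2 c3 F) (simp add: 4 algebra_simps)
  qed (simp_all add: odd_double_fact_Suc numeral_2_eq_2 numeral_3_eq_3)
qed

lemma card_perfect_matchings_meeting:
  assumes V: "finite V" "card V = 2 * n" and M: "M \<in> perfect_matchings V" and "e \<notin> M" "n \<ge> 2"
  shows "card {N \<in> perfect_matchings V. e \<in> N \<and> N \<inter> M \<noteq> {}}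
    \<le> 31 / 72 * real (odd_double_fact (n - 1))"
proof (cases "e \<subseteq> V \<and> card e = 2")
  case False
  then have "{N \<in> perfect_matchings V. e \<in> N \<and> N \<inter> M \<noteq> {}} = {}"
    by (auto simp: perfect_matchings_iff partition_on_def)
  then have "card {N \<in> perfect_matchings V. e \<in> N \<and> N \<inter> M \<noteq> {}} = 0"
    by (simp only: card.empty)
  then show ?thesis by linarith
next
  case True
  define X where "X = {N \<in> perfect_matchings V. e \<in> N}"
  \<comment> \<open>Edges of \<open>M\<close> that touch \<open>e\<close> cannot lie in a matching
    together with \<open>e\<close>, so only those in \<open>K\<close> matter.\<close>
  define K where "K = {d \<in> M. d \<inter> e = {}}"
  define k where "k = n - 2"
  have "finite X" using finite_perfect_matchings[OF V(1)] by (simp add: X_def)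
  have "finite M" using perfect_matching_finite V M by blast
  then have "finite K" by (simp add: K_def)
  have cK: "card K = k"
    using card_edges_avoiding_edge[OF M] True V \<open>e \<notin> M\<close> card_perfect_matching[OF M]
    by (simp add: K_def k_def)
  have meetK: "N \<inter> M = N \<inter> K" if "N \<in> X" for N
  proof -
    have "disjoint N" "e \<in> N" using that by (auto simp: X_def perfect_matchings_iff partition_on_def)
    then have "d \<inter> e = {}" if "d \<in> N" "d \<in> M" for d
      using that \<open>e \<notin> M\<close> pairwiseD[of disjnt N d e] by (auto simp: disjnt_def)
    then show ?thesis by (auto simp: K_def)
  qed
  \<comment> \<open>The Bonferroni sum of order \<open>j\<close>, by counting pairs of a matching
    \<open>N\<close> and a \<open>j\<close>-subset \<open>S\<close> of \<open>N \<inter> K\<close>: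
    each such \<open>S\<close> together with \<open>e\<close> is a partial matching with
    \<open>j + 1\<close> edges.\<close>
  have count: "(\<Sum>N\<in>X. card (N \<inter> K) choose j) = (k choose j) * odd_double_fact (n - 1 - j)" for j
  proof -
    define T where "T = {T. T \<subseteq> K \<and> card T = j}"
    have "finite T" using \<open>finite K\<close> by (auto simp: T_def)
    have "(\<Sum>N\<in>X. card (N \<inter> K) choose j) = (\<Sum>N\<in>X. card {S\<in>T. S \<subseteq> N})"
    proof (rule sum.cong)
      fix N assume "N \<in> X"
      have "card (N \<inter> K) choose j = card {S. S \<subseteq> N \<inter> K \<and> card S = j}"
        using n_subsets[OF finite_Int[OF disjI2[OF \<open>finite K\<close>]], of N j] by (rule sym)
      also have "{S. S \<subseteq> N \<inter> K \<and> card S = j} = {S\<in>T. S \<subseteq> N}" by (auto simp: T_def)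
      finally show "card (N \<inter> K) choose j = card {S\<in>T. S \<subseteq> N}" .
    qed simp
    also have "\<dots> = (\<Sum>S\<in>T. odd_double_fact (n - 1 - j))"
    proof (rule sum_multicount_gen[OF \<open>finite X\<close> \<open>finite T\<close>], rule ballI)
      fix S assume "S \<in> T"
      then have S: "S \<subseteq> K" "card S = j" by (auto simp: T_def)
      have "finite S" using S \<open>finite K\<close> finite_subset by blast
      have SM: "S \<subseteq> M" using S by (auto simp: K_def)
      have "e \<notin> S" using SM \<open>e \<notin> M\<close> by auto
      have "disjoint S"
        using M SM by (auto simp: perfect_matchings_iff partition_on_def intro: pairwise_subset)
      then have "disjoint (insert e S)"
        using S by (fastforce simp: K_def pairwise_insert disjnt_def)
      moreover have "\<forall>d\<in>insert e S. card d = 2" "\<Union> (insert e S) \<subseteq> V"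
        using True SM M by (auto simp: perfect_matchings_iff partition_on_def)
      ultimately have "card {N \<in> perfect_matchings V. insert e S \<subseteq> N}
          = odd_double_fact (n - card (insert e S))"
        using V by (intro card_perfect_matchings_containing)
      moreover have "{N \<in> perfect_matchings V. insert e S \<subseteq> N} = {N\<in>X. S \<subseteq> N}"
        by (auto simp: X_def)
      ultimately show "card {N\<in>X. S \<subseteq> N} = odd_double_fact (n - 1 - j)"
        using \<open>finite S\<close> \<open>e \<notin> S\<close> S by simp
    qed
    also have "\<dots> = (k choose j) * odd_double_fact (n - 1 - j)"
      using n_subsets[OF \<open>finite K\<close>, of j] cK by (simp add: T_def)
    finally show ?thesis .
  qed
  have "card {N\<in>X. N \<inter> K \<noteq> {}} + (\<Sum>N\<in>X. card (N \<inter> K) choose 2)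
      = (\<Sum>N\<in>X. of_bool (N \<inter> K \<noteq> {}) + (card (N \<inter> K) choose 2))"
    using \<open>finite X\<close> by (simp add: sum.distrib sum.If_cases of_bool_def Int_def)
  also have "\<dots> \<le> (\<Sum>N\<in>X. (card (N \<inter> K) choose 1) + (card (N \<inter> K) choose 3))"
  proof (rule sum_mono)
    fix N assume "N \<in> X"
    show "of_bool (N \<inter> K \<noteq> {}) + (card (N \<inter> K) choose 2)
      \<le> (card (N \<inter> K) choose 1) + (card (N \<inter> K) choose 3)"
    proof (cases "N \<inter> K = {}")
      case False
      then have "card (N \<inter> K) \<ge> 1"
        using \<open>finite K\<close> by (simp add: Suc_le_eq card_gt_0_iff)
      from binomial_Bonferroni[OF this] False show ?thesis by simp
    qed (simp add: numeral_2_eq_2)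
  qed
  also have "\<dots> = k * odd_double_fact (n - 1 - 1) + (k choose 3) * odd_double_fact (n - 1 - 3)"
    using count[of 1] count[of 3] by (simp only: sum.distrib binomial_n_n) simp
  finally have "card {N\<in>X. N \<inter> K \<noteq> {}} + (k choose 2) * odd_double_fact (n - 1 - 2)
    \<le> k * odd_double_fact (n - 1 - 1) + (k choose 3) * odd_double_fact (n - 1 - 3)"
    by (simp only: count)
  moreover have "n - 1 - 1 = k" "n - 1 - 2 = k - 1" "n - 1 - 3 = k - 2" "n - 1 = k + 1"
    using \<open>n \<ge> 2\<close> by (auto simp: k_def)
  ultimately have "card {N\<in>X. N \<inter> K \<noteq> {}} + (k choose 2) * odd_double_fact (k - 1)
    \<le> k * odd_double_fact k + (k choose 3) * odd_double_fact (k - 2)"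
    by simp
  then have "real (card {N\<in>X. N \<inter> K \<noteq> {}}) + (k choose 2) * odd_double_fact (k - 1)
    \<le> k * odd_double_fact k + (k choose 3) * odd_double_fact (k - 2)"
    by (simp flip: of_nat_add of_nat_mult)
  also note Bonferroni_bound
  finally have "real (card {N\<in>X. N \<inter> K \<noteq> {}}) \<le> 31 / 72 * real (odd_double_fact (n - 1))"
    using \<open>n - 1 = k + 1\<close> by simp
  moreover have "{N\<in>X. N \<inter> K \<noteq> {}} = {N \<in> perfect_matchings V. e \<in> N \<and> N \<inter> M \<noteq> {}}"
    using meetK by (auto simp: X_def)
  ultimately show ?thesis by simp
qed

section \<open>Branching over the edges of a missed matching\<close>

text \<open>The surviving edges are disjoint pairs among the \<open>2 * n - 2 * card S\<close>
  vertices that \<open>S\<close> leaves free.\<close>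

lemma card_edges_avoiding_le:
  assumes "finite V" "card V = 2 * n" "M \<in> perfect_matchings V"
    and S: "disjoint S" "\<forall>e\<in>S. card e = 2" "\<Union> S \<subseteq> V"
  shows "card {e \<in> M. e \<inter> \<Union> S = {}} \<le> n - card S"
proof -
  define K where "K = {e \<in> M. e \<inter> \<Union> S = {}}"
  have M: "\<Union> M = V" "disjoint M" "\<forall>e\<in>M. card e = 2"
    using assms by (auto simp: perfect_matchings_iff partition_on_def)
  have "disjoint K" "\<forall>e\<in>K. card e = 2"
    using M by (auto simp: K_def intro: pairwise_subset)
  then have "2 * card K = card (\<Union> K)" by (simp add: card_Union_pairs)
  also have "\<dots> \<le> card (V - \<Union> S)"
    using assms(1) M(1) by (intro card_mono) (auto simp: K_def)
  also have "\<dots> = 2 * n - 2 * card S"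
    using assms finite_subset[OF S(3) assms(1)] by (simp add: card_Diff_subset card_Union_pairs)
  finally show ?thesis unfolding K_def by simp
qed

text \<open>A member containing \<open>S\<close> shares an edge \<open>e\<close> with
  \<open>M\<close>. As \<open>e\<close> is not in \<open>S\<close> but lies in one disjoint family
  with it, \<open>e\<close> avoids all vertices of \<open>S\<close>; the union bound over such
  \<open>e\<close> follows.\<close>

lemma card_containing_le_mult:
  assumes "finite M" "finite A" "\<And>N. N \<in> A \<Longrightarrow> N \<inter> M \<noteq> {}"
    and disj: "\<And>N. N \<in> A \<Longrightarrow> disjoint N"
    and "S \<inter> M = {}"
    and b: "\<And>e. e \<in> M \<Longrightarrow> card {N \<in> A. insert e S \<subseteq> N} \<le> b"
  shows "card {N \<in> A. S \<subseteq> N} \<le> card {e \<in> M. e \<inter> \<Union> S = {}} * b"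
proof -
  define K where "K = {e \<in> M. e \<inter> \<Union> S = {}}"
  have "finite K" using assms(1) by (simp add: K_def)
  have "{N \<in> A. S \<subseteq> N} \<subseteq> (\<Union>e\<in>K. {N \<in> A. insert e S \<subseteq> N})"
  proof
    fix N assume N: "N \<in> {N \<in> A. S \<subseteq> N}"
    then obtain e where e: "e \<in> N" "e \<in> M" using assms(3) by blast
    have "disjnt e d" if "d \<in> S" for d
      using pairwiseD[OF disj[of N], of e d] N e that assms(5) by blast
    then have "e \<in> K" using e by (auto simp: K_def disjnt_def)
    then show "N \<in> (\<Union>e\<in>K. {N \<in> A. insert e S \<subseteq> N})" using N e by blast
  qed
  then have "card {N \<in> A. S \<subseteq> N} \<le> card (\<Union>e\<in>K. {N \<in> A. insert e S \<subseteq> N})"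
    using \<open>finite K\<close> assms(2) by (intro card_mono) auto
  also have "\<dots> \<le> (\<Sum>e\<in>K. card {N \<in> A. insert e S \<subseteq> N})"
    using \<open>finite K\<close> by (rule card_UN_le)
  also have "\<dots> \<le> card K * b"
    using sum_bounded_above[of K "\<lambda>e. card {N \<in> A. insert e S \<subseteq> N}" b] b by (simp add: K_def)
  finally show ?thesis unfolding K_def .
qed

text \<open>
  Bounds \<open>|A\<^sub>S|\<close> for \<open>|S| = s\<close>: one factor \<open>n - i\<close> for each edge added to \<open>S\<close> until it has \<open>t\<close> edges,
  then the number of all perfect matchings containing it.
\<close>

definition link_bound :: "nat \<Rightarrow> nat \<Rightarrow> nat \<Rightarrow> nat" where
  "link_bound n t s = (\<Prod>i = s..<t. n - i) * odd_double_fact (n - t)"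

section \<open>Numerical estimates for \<open>link_bound\<close>\<close>

text \<open>Enlarging \<open>t\<close> by one trades the top factor \<open>2 * (n - t) - 1\<close>
  of the double factorial for \<open>n - t\<close>, roughly a halving.\<close>

lemma link_bound_Suc:
  assumes "s \<le> t" "t < n"
  shows "(2 * (n - t) - 1) * link_bound n (Suc t) s = (n - t) * link_bound n t s"
proof -
  have "2 * (n - t) - 1 = 2 * (n - Suc t) + 1" using assms(2) by simp
  then have "odd_double_fact (n - t) = (2 * (n - t) - 1) * odd_double_fact (n - Suc t)"
    using odd_double_fact_Suc[of "n - Suc t"] Suc_diff_Suc[OF assms(2)] by metis
  then show ?thesis using assms by (simp add: link_bound_def)
qed

text \<open>The product \<open>t * link_bound n t 2\<close> does not grow from \<open>t = 4\<close>
  to \<open>n - 1\<close>, and the step from 3 to 4 multiplies it by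
  \<open>4/3 * (n - 3) / (2 * (n - 3) - 1)\<close>, at most \<open>8/9\<close> with equality at
  \<open>n = 5\<close>. This gain pays for the last step to \<open>t = n\<close> in
  \<open>cover_bound\<close>.\<close>

lemma link_bound_le:
  assumes "n \<ge> 5" "4 \<le> t" "t \<le> n - 1"
  shows "9 * (t * link_bound n t 2) \<le> 8 * (3 * link_bound n 3 2)"
  using assms(2,3)
proof (induction t rule: dec_induct)
  case base
  have rec: "(2 * (n - 3) - 1) * link_bound n 4 2 = (n - 3) * link_bound n 3 2"
    using link_bound_Suc[of 2 3 n] assms by simp
  have "(2 * (n - 3) - 1) * (9 * (4 * link_bound n 4 2))
      = 36 * (n - 3) * link_bound n 3 2"
    using rec by simp
  also have "\<dots> \<le> (24 * (2 * (n - 3) - 1)) * link_bound n 3 2"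
    using assms by (intro mult_right_mono) auto
  finally have "(2 * (n - 3) - 1) * (9 * (4 * link_bound n 4 2))
      \<le> (2 * (n - 3) - 1) * (8 * (3 * link_bound n 3 2))" by (simp add: algebra_simps)
  then show ?case using assms by simp
next
  case (step t)
  define m where "m = n - t"
  have m: "m \<ge> 2" using step by (simp add: m_def)
  have rec: "(2 * m - 1) * link_bound n (Suc t) 2 = m * link_bound n t 2"
    using link_bound_Suc[of 2 t n] step by (simp add: m_def)
  obtain l where l: "m = l + 2"
    using m le_Suc_ex[of 2 m] by auto
  \<comment> \<open>The halving beats the growth \<open>Suc t / t\<close> as long as
    \<open>m \<ge> 2\<close>, which is why the range stops at \<open>n - 1\<close>.\<close>
  have "Suc t * m \<le> t * (2 * m - 1)"
  proof -
    have "l + 2 \<le> t * l + t" using step by (intro add_mono) auto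
    then show ?thesis unfolding l by (simp add: algebra_simps)
  qed
  then have "Suc t * m * link_bound n t 2 \<le> t * (2 * m - 1) * link_bound n t 2"
    by (rule mult_right_mono) simp
  moreover have "(2 * m - 1) * (Suc t * link_bound n (Suc t) 2) = Suc t * m * link_bound n t 2"
    unfolding mult.left_commute[of _ "Suc t"] rec by (rule mult.assoc[symmetric])
  ultimately have "(2 * m - 1) * (Suc t * link_bound n (Suc t) 2)
      \<le> (2 * m - 1) * (t * link_bound n t 2)"
    by (simp only: ac_simps)
  then have "Suc t * link_bound n (Suc t) 2 \<le> t * link_bound n t 2"
    using m by (subst (asm) mult_le_cancel1) auto
  then show ?case using step by linarith
qed

text \<open>Up to a factor \<open>10/9\<close> the worst case is \<open>t = 3\<close>. There the
  ratio to the star size is \<open>3 * (n - 2)^2 / ((2 * n - 3) * (2 * n - 5))\<close>, and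
  \<open>10/9\<close> times it is largest at \<open>n = 5\<close>, where it equals
  \<open>6/7\<close>.\<close>

lemma cover_bound:
  assumes "n \<ge> 5" "3 \<le> t" "t \<le> n"
  shows "7 * (t * ((n - 2) * link_bound n t 2)) \<le> 6 * odd_double_fact (n - 1)"
proof -
  have t3: "9 * (t * link_bound n t 2) \<le> 10 * (3 * link_bound n 3 2)"
  proof -
    consider "t = 3" | "t = n" | "4 \<le> t \<and> t \<le> n - 1" using assms by linarith
    then show ?thesis
    proof cases
      case 2
      \<comment> \<open>Both factors in \<open>link_bound_Suc\<close> are 1 at
        \<open>t = n - 1\<close>: the last step halves nothing and costs \<open>n / (n - 1)\<close>,
        at most \<open>5/4\<close>, which turns \<open>8/9\<close> into \<open>10/9\<close>.\<close>
      have last: "link_bound n n 2 = link_bound n (n - 1) 2"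
        using link_bound_Suc[of 2 "n - 1" n] assms by simp
      have "4 * n * link_bound n (n - 1) 2 \<le> 5 * (n - 1) * link_bound n (n - 1) 2"
        using assms by (intro mult_right_mono) auto
      moreover have "9 * ((n - 1) * link_bound n (n - 1) 2) \<le> 8 * (3 * link_bound n 3 2)"
        using assms by (intro link_bound_le) auto
      ultimately have "9 * (n * link_bound n (n - 1) 2) \<le> 10 * (3 * link_bound n 3 2)"
        unfolding mult.assoc by linarith
      then show ?thesis by (simp only: 2 last)
    qed (use link_bound_le[of n t] assms in auto)
  qed
  define m where "m = n - 5"
  have n: "n = m + 5" using assms by (simp add: m_def)
  define F where "F = odd_double_fact (n - 3)"
  have f: "odd_double_fact (n - 1) = (2 * m + 7) * ((2 * m + 5) * F)"
    using odd_double_fact_Suc[of "m + 3"] odd_double_fact_Suc[of "m + 2"]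
    by (simp add: n F_def eval_nat_numeral algebra_simps)
  have l3: "link_bound n 3 2 = (m + 3) * F"
    by (simp add: link_bound_def F_def n numeral_3_eq_3 numeral_2_eq_2)
  \<comment> \<open>\<open>315 = 9 * 35 = 7 * 45\<close> accommodates both the \<open>9\<close> of
    \<open>t3\<close> and the final \<open>7\<close>.\<close>
  have "315 * (t * ((n - 2) * link_bound n t 2)) = 35 * (n - 2) * (9 * (t * link_bound n t 2))"
    by simp
  also have "\<dots> \<le> 35 * (n - 2) * (10 * (3 * link_bound n 3 2))"
    using t3 by (intro mult_left_mono) auto
  also have "\<dots> = (1050 * (m + 3) * (m + 3)) * F" unfolding l3 by (simp add: n)
  also have "\<dots> \<le> (270 * (2 * m + 7) * (2 * m + 5)) * F"
    by (intro mult_right_mono) (auto simp: algebra_simps)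
  also have "\<dots> = 270 * odd_double_fact (n - 1)" unfolding f by simp
  finally show ?thesis by simp
qed

section \<open>Intersecting families and their covers\<close>

definition intersecting :: "'a set set \<Rightarrow> bool" where
  "intersecting A \<longleftrightarrow> (\<forall>M\<in>A. \<forall>N\<in>A. M \<inter> N \<noteq> {})"

text \<open>Induction downwards from \<open>s = t\<close>, where \<open>A\<close> is replaced by all
  perfect matchings. Below \<open>t\<close>, some member of \<open>A\<close> misses \<open>S\<close>
  and yields the factor \<open>n - s\<close>.\<close>

lemma card_containing_le_link_bound:
  assumes V: "finite V" "card V = 2 * n" and A: "A \<subseteq> perfect_matchings V" "intersecting A"
    and uncovered: "\<And>S. finite S \<Longrightarrow> card S < t \<Longrightarrow> \<exists>M\<in>A. S \<inter> M = {}"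
    and "s \<le> t" "finite S" "card S = s"
  shows "card {N \<in> A. S \<subseteq> N} \<le> link_bound n t s"
  using assms(6-8)
proof (induction s arbitrary: S rule: inc_induct)
  case base
  have "card {N \<in> A. S \<subseteq> N} \<le> card {N \<in> perfect_matchings V. S \<subseteq> N}"
    using A finite_perfect_matchings[OF V(1)] by (intro card_mono) auto
  also have "\<dots> \<le> odd_double_fact (n - card S)"
    using V by (rule card_perfect_matchings_containing_le)
  finally show ?case using base by (simp add: link_bound_def)
next
  case (step s)
  show ?case
  proof (cases "{N \<in> A. S \<subseteq> N} = {}")
    case False
    then obtain N where N: "N \<in> perfect_matchings V" "S \<subseteq> N" using A by blast
    then have S: "disjoint S" "\<forall>e\<in>S. card e = 2" "\<Union> S \<subseteq> V"
      by (auto simp: perfect_matchings_iff partition_on_def intro: pairwise_subset)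
    obtain M where M: "M \<in> A" "S \<inter> M = {}" using uncovered[of S] step by auto
    then have MV: "M \<in> perfect_matchings V" using A by blast
    have "card {N \<in> A. S \<subseteq> N} \<le> card {e \<in> M. e \<inter> \<Union> S = {}} * link_bound n t (Suc s)"
    proof (rule card_containing_le_mult)
      show "finite M" using MV by (rule perfect_matching_finite[OF V(1)])
      show "finite A" using A finite_perfect_matchings[OF V(1)] finite_subset by blast
      show "N \<inter> M \<noteq> {}" if "N \<in> A" for N using A(2) M(1) that by (simp add: intersecting_def)
      show "disjoint N" if "N \<in> A" for N
        using A(1) that by (auto simp: perfect_matchings_iff partition_on_def)
      show "card {N \<in> A. insert e S \<subseteq> N} \<le> link_bound n t (Suc s)" if "e \<in> M" for e
      proof -
        have "e \<notin> S" using that M by blast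
        then show ?thesis using step.prems by (intro step.IH) simp_all
      qed
    qed (rule M)
    also have "\<dots> \<le> (n - s) * link_bound n t (Suc s)"
      using card_edges_avoiding_le[OF V MV S] step.prems by (intro mult_right_mono) simp_all
    also have "\<dots> = link_bound n t s"
      using step.hyps by (simp add: link_bound_def prod.atLeast_Suc_lessThan)
    finally show ?thesis .
  qed (simp only: card.empty)
qed

text \<open>The first branching is treated apart to get the factor \<open>n - 2\<close> where
  \<open>link_bound n t 1\<close> has \<open>n - 1\<close>. With \<open>n - 1\<close>, the case
  \<open>n = 5\<close>, \<open>t = 3\<close> would give 108, more than the star size 105.\<close>

lemma card_containing_edge_le_link_bound:
  assumes V: "finite V" "card V = 2 * n" and A: "A \<subseteq> perfect_matchings V" "intersecting A"
    and uncovered: "\<And>S. finite S \<Longrightarrow> card S < t \<Longrightarrow> \<exists>M\<in>A. S \<inter> M = {}"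
    and "2 \<le> t"
  shows "card {N \<in> A. e \<in> N} \<le> (n - 2) * link_bound n t 2"
proof (cases "{N \<in> A. e \<in> N} = {}")
  case False
  then obtain N where N: "N \<in> perfect_matchings V" "e \<in> N" using A by blast
  then have e: "e \<subseteq> V" "card e = 2"
    by (auto simp: perfect_matchings_iff partition_on_def)
  obtain M where M: "M \<in> A" "{e} \<inter> M = {}" using uncovered[of "{e}"] assms(6) by auto
  then have MV: "M \<in> perfect_matchings V" using A by blast
  have "card {N \<in> A. {e} \<subseteq> N} \<le> card {d \<in> M. d \<inter> \<Union> {e} = {}} * link_bound n t 2"
  proof (rule card_containing_le_mult)
    show "finite M" using MV by (rule perfect_matching_finite[OF V(1)])
    show "finite A" using A finite_perfect_matchings[OF V(1)] finite_subset by blast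
    show "N \<inter> M \<noteq> {}" if "N \<in> A" for N using A(2) M(1) that by (simp add: intersecting_def)
    show "disjoint N" if "N \<in> A" for N
      using A(1) that by (auto simp: perfect_matchings_iff partition_on_def)
    show "card {N \<in> A. insert d {e} \<subseteq> N} \<le> link_bound n t 2" if "d \<in> M" for d
    proof -
      have "d \<noteq> e" using that M by blast
      then show ?thesis
        by (intro card_containing_le_link_bound[OF V A uncovered \<open>2 \<le> t\<close>]) auto
    qed
  qed (rule M)
  also have "card {d \<in> M. d \<inter> \<Union> {e} = {}} = n - 2"
    using card_edges_avoiding_edge[OF MV V(1) e] M card_perfect_matching[OF MV] V(2) by simp
  finally show ?thesis by simp
qed (simp only: card.empty)

text \<open>
  The gain of \<open>card M - 1\<close> over the union bound settles \<open>t = n\<close> for \<open>n \<in> {3, 4}\<close>.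
\<close>

lemma card_plus_le_sum_degrees:
  assumes "finite A" "finite M" "M \<in> A" "intersecting A"
  shows "card A + (card M - 1) \<le> (\<Sum>e\<in>M. card {N \<in> A. e \<in> N})"
proof -
  \<comment> \<open>In the double count \<open>M\<close> itself is met \<open>card M\<close> times,
    every other member at least once.\<close>
  have "card A + (card M - 1) = card M + (\<Sum>N\<in>A - {M}. 1)"
  proof -
    have "card A \<ge> 1" "card M \<ge> 1"
      using assms by (auto simp: Suc_le_eq card_gt_0_iff intersecting_def)
    then show ?thesis using assms by simp
  qed
  also have "\<dots> \<le> card M + (\<Sum>N\<in>A - {M}. card {e \<in> M. e \<in> N})"
  proof (intro add_left_mono sum_mono)
    fix N assume "N \<in> A - {M}"
    then have "{e \<in> M. e \<in> N} \<noteq> {}" using assms by (auto simp: intersecting_def)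
    then show "1 \<le> card {e \<in> M. e \<in> N}" using assms(2) by (simp add: Suc_le_eq card_gt_0_iff)
  qed
  also have "\<dots> = (\<Sum>N\<in>A. card {e \<in> M. e \<in> N})"
    using assms by (simp add: sum.remove[of A M])
  also have "\<dots> = (\<Sum>e\<in>M. card {N \<in> A. e \<in> N})"
    using assms by (intro sum_multicount_gen) auto
  finally show ?thesis .
qed

section \<open>Families that lie in no star\<close>

text \<open>Cases on the covering number \<open>t\<close>: \<open>t = 2\<close> gives
  \<open>31/36\<close>, \<open>t \<ge> 3\<close> with \<open>n \<ge> 5\<close> gives
  \<open>6/7\<close>, and the rest is computed. The constant comes from \<open>n = t = 4\<close>,
  where the bound is 13 out of 15.\<close>

theorem card_nontrivial_intersecting_le:
  assumes V: "finite V" "card V = 2 * n" and "n \<ge> 1"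
    and A: "A \<subseteq> perfect_matchings V" "intersecting A"
    and nontrivial: "\<And>e. \<exists>M\<in>A. e \<notin> M"
  shows "real (card A) \<le> 13 / 15 * real (odd_double_fact (n - 1))"
proof -
  have "finite A" using A finite_perfect_matchings[OF V(1)] finite_subset by blast
  define covers where "covers C \<longleftrightarrow> finite C \<and> (\<forall>M\<in>A. C \<inter> M \<noteq> {})" for C
  obtain M where M: "M \<in> A" using nontrivial by blast
  then have MV: "M \<in> perfect_matchings V" using A by blast
  have finM: "finite M" using MV by (rule perfect_matching_finite[OF V(1)])
  have cM: "card M = n" using card_perfect_matching[OF MV] V by simp
  \<comment> \<open>Every member of \<open>A\<close> is a cover, so a minimum cover exists and has
    at most \<open>n\<close> edges.\<close>
  have "covers M" using M A finM by (auto simp: covers_def intersecting_def)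
  then obtain C where C: "covers C" "\<And>D. covers D \<Longrightarrow> card C \<le> card D"
    using arg_min_nat_lemma[of covers M card] by blast
  define t where "t = card C"
  have uncovered: "\<exists>M\<in>A. S \<inter> M = {}" if "finite S" "card S < t" for S
    using C(2)[of S] that by (auto simp: covers_def t_def)
  have "t \<le> n" using C(2)[OF \<open>covers M\<close>] cM by (simp add: t_def)
  have "finite C" using C by (simp add: covers_def)
  have "t \<noteq> 0" using C(1) M \<open>finite C\<close> by (auto simp: t_def covers_def)
  moreover have "t \<noteq> 1"
  proof
    assume "t = 1"
    then obtain e where "C = {e}" by (auto simp: t_def card_1_singleton_iff)
    then show False using C(1) nontrivial[of e] by (auto simp: covers_def)
  qed
  ultimately have "t \<ge> 2" by simp
  have cover: "card A \<le> (\<Sum>e\<in>C. card {N \<in> A. e \<in> N})"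
  proof -
    have "A \<subseteq> (\<Union>e\<in>C. {N \<in> A. e \<in> N})" using C(1) by (auto simp: covers_def)
    then have "card A \<le> card (\<Union>e\<in>C. {N \<in> A. e \<in> N})"
      using \<open>finite C\<close> \<open>finite A\<close> by (intro card_mono) auto
    also have "\<dots> \<le> (\<Sum>e\<in>C. card {N \<in> A. e \<in> N})" using \<open>finite C\<close> by (rule card_UN_le)
    finally show ?thesis .
  qed
  have deg: "card {N \<in> A. e \<in> N} \<le> (n - 2) * link_bound n t 2" for e
    by (rule card_containing_edge_le_link_bound[OF V A uncovered \<open>t \<ge> 2\<close>])
  have le: "card A \<le> t * ((n - 2) * link_bound n t 2)"
    using cover sum_bounded_above[of C "\<lambda>e. card {N \<in> A. e \<in> N}", OF deg]
    by (simp add: t_def)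
  \<comment> \<open>\<open>M\<close> replaces the minimum cover. This loses nothing when
    \<open>t = n\<close>, and the surplus \<open>n - 1\<close> is what brings
    \<open>n = t = 3\<close> and \<open>n = t = 4\<close> below \<open>13/15\<close>.\<close>
  have le_M: "card A + (n - 1) \<le> n * ((n - 2) * link_bound n t 2)"
    using card_plus_le_sum_degrees[OF \<open>finite A\<close> finM M A(2)] cM
      sum_bounded_above[of M "\<lambda>e. card {N \<in> A. e \<in> N}", OF deg] by simp
  consider "t = 2" | "t \<ge> 3" "n \<ge> 5" | "t = 3" "n = 3" | "t = 3" "n = 4" | "t = 4" "n = 4"
    using \<open>t \<ge> 2\<close> \<open>t \<le> n\<close> by linarith
  then show ?thesis
  proof cases
    case 1
    have "real (card {N \<in> A. e \<in> N}) \<le> 31 / 72 * real (odd_double_fact (n - 1))" for e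
    proof -
      \<comment> \<open>As \<open>L\<close> lies in \<open>A\<close> and avoids \<open>e\<close>,
        every member through \<open>e\<close> must meet it elsewhere.\<close>
      obtain L where L: "L \<in> A" "e \<notin> L" using nontrivial by blast
      have "{N \<in> A. e \<in> N} \<subseteq> {N \<in> perfect_matchings V. e \<in> N \<and> N \<inter> L \<noteq> {}}"
        using L A by (auto simp: intersecting_def)
      then have "card {N \<in> A. e \<in> N}
          \<le> card {N \<in> perfect_matchings V. e \<in> N \<and> N \<inter> L \<noteq> {}}"
        using finite_perfect_matchings[OF V(1)] by (intro card_mono) auto
      also have "real \<dots> \<le> 31 / 72 * real (odd_double_fact (n - 1))"
        using card_perfect_matchings_meeting[OF V, of L e] L A 1 \<open>t \<le> n\<close> by auto
      finally show ?thesis by simp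
    qed
    then have "(\<Sum>e\<in>C. real (card {N \<in> A. e \<in> N})) \<le> 2 * (31 / 72 * real (odd_double_fact (n - 1)))"
      using sum_bounded_above[of C "\<lambda>e. real (card {N \<in> A. e \<in> N})"
          "31 / 72 * real (odd_double_fact (n - 1))"] 1 by (simp add: t_def)
    moreover have "real (card A) \<le> (\<Sum>e\<in>C. real (card {N \<in> A. e \<in> N}))"
      using cover by (simp flip: of_nat_sum)
    ultimately have "real (card A) \<le> 2 * (31 / 72 * real (odd_double_fact (n - 1)))"
      by linarith
    then show ?thesis by simp
  next
    case 2
    then have "7 * card A \<le> 6 * odd_double_fact (n - 1)"
      using cover_bound[of n t] le \<open>t \<le> n\<close> by linarith
    then show ?thesis by linarith
  next
    case 3
    then show ?thesis using le_M
      by (simp add: link_bound_def odd_double_fact_def eval_nat_numeral)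
  next
    case 4
    then show ?thesis using le
      by (simp add: link_bound_def odd_double_fact_def eval_nat_numeral)
  next
    case 5
    then show ?thesis using le_M
      by (simp add: link_bound_def odd_double_fact_def eval_nat_numeral)
  qed
qed

section \<open>Independent sets of the perfect matching graph\<close>

theorem theorem1p9:
  shows "\<exists>\<delta>::real. \<delta> > 0 \<and>
    (\<forall>n::nat. n \<ge> 1 \<longrightarrow>
      (\<forall>A. independent_set (matching_graph_verts n) (matching_graph_edges n) A \<longrightarrow>
           real (card A) \<ge> (1 - \<delta>) * real (odd_double_fact (n - 1)) \<longrightarrow>
           (\<exists>e \<in> complete_graph_edges (2 * n). A \<subseteq> star n e)))"
proof (intro exI[of _ "1 / 8"] conjI allI impI)
  fix n :: nat and A
  assume "n \<ge> 1"
    and ind: "independent_set (matching_graph_verts n) (matching_graph_edges n) A"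
    and large: "real (card A) \<ge> (1 - 1 / 8) * real (odd_double_fact (n - 1))"
  let ?V = "{1..2 * n}"
  have A: "A \<subseteq> perfect_matchings ?V"
    using ind by (simp add: independent_set_def matching_graph_verts_eq)
  have "intersecting A"
    unfolding intersecting_def
  proof (intro ballI)
    fix M N assume MN: "M \<in> A" "N \<in> A"
    show "M \<inter> N \<noteq> {}"
    \<comment> \<open>Independence only concerns distinct members; for equal ones nonemptiness comes
      from \<open>n \<ge> 1\<close>.\<close>
    proof (cases "M = N")
      case True
      have "card M \<noteq> 0"
        using card_perfect_matching[of M ?V] MN A \<open>n \<ge> 1\<close> by auto
      then show ?thesis using True by auto
    next
      case False
      then have "{M, N} \<notin> matching_graph_edges n"
        using ind MN by (simp add: independent_set_def indep_def)
      then show ?thesis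
        using MN A by (auto simp: matching_graph_edges_def matching_graph_verts_eq)
    qed
  qed
  have pos: "real (odd_double_fact (n - 1)) > 0" using odd_double_fact_pos by simp
  obtain e where e: "\<forall>M\<in>A. e \<in> M"
  proof (rule ccontr)
    assume "\<not> thesis"
    then have "\<exists>M\<in>A. e \<notin> M" for e using that by blast
    then have "real (card A) \<le> 13 / 15 * real (odd_double_fact (n - 1))"
      using \<open>n \<ge> 1\<close> A \<open>intersecting A\<close> by (intro card_nontrivial_intersecting_le[of ?V]) auto
    \<comment> \<open>The witness \<open>1 / 8\<close> works because it is below
      \<open>2 / 15 = 1 - 13 / 15\<close>.\<close>
    moreover have "7 / 8 * real (odd_double_fact (n - 1)) \<le> real (card A)" using large by simp
    ultimately show False using pos by linarith
  qed
  \<comment> \<open>The common element \<open>e\<close> is so far arbitrary; a member of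
    \<open>A\<close> is needed to see that it is an edge, and the lower bound on
    \<open>card A\<close> provides one.\<close>
  have "card A > 0" using large pos by (cases "card A") auto
  then obtain M where "M \<in> A" by fastforce
  then have "M \<subseteq> complete_graph_edges (2 * n)"
    using A by (auto simp: perfect_matchings_def perfect_matching_def complete_graph_edges_def
        complete_graph_verts_def)
  then have "e \<in> complete_graph_edges (2 * n)" using e \<open>M \<in> A\<close> by blast
  moreover have "A \<subseteq> star n e"
    using e A by (auto simp: star_def matching_graph_verts_eq)
  ultimately show "\<exists>e \<in> complete_graph_edges (2 * n). A \<subseteq> star n e" by blast
qed simp

end
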